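(* Let $\{G_i\}_{i\in I}$ be an HS-frame for $\mathcal{H}$ with respect to $\mathcal{K}$ with bounds $A,B$, and let $\{H_i\}_{i\in I}$ be a family of bounded linear operators from $\mathcal{H}$ into $\mathcal{C}_2(\mathcal{K})$. Let $\lambda,\mu,\nu\geq 0$ be such that for every finite subset $J\subseteq I$ and all $A_i\in\mathcal{C}_2(\mathcal{K})$ $(i\in J)$, $$\Big\|\sum_{i\in J}(G_i^*A_i-H_i^*A_i)\Big\|^2\leq\lambda\Big\|\sum_{i\in J}G_i^*A_i\Big\|^2+\mu\Big\|\sum_{i\in J}G_i^*A_i\Big\|\,\Big\|\sum_{i\in J}H_i^*A_i\Big\|+\nu\Big\|\sum_{i\in J}H_i^*A_i\Big\|^2.$$ If there exists an $\epsilon>0$ such that $\max\left\{\lambda+\mu\epsilon,\ \nu+\frac{\mu}{4\epsilon}\right\}<1$, then $\{H_i\}_{i\in I}$ is an HS-frame for $\mathcal{H}$ with respect to $\mathcal{K}$ with (lower and upper, respectively) frame bounds $$A\left(\frac{1-\sqrt{\lambda+\mu\epsilon}}{1+\sqrt{\nu+\frac{\mu}{4\epsilon}}}\right)^2\quad\text{and}\quad B\left(\frac{1+\sqrt{\lambda+\mu\epsilon}}{1-\sqrt{\nu+\frac{\mu}{4\epsilon}}}\right)^2.$$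
   Context: $\mathcal{H}$ and $\mathcal{K}$ are separable Hilbert spaces and $I$ is a countable index set. $\mathcal{C}_2(\mathcal{K})$ is the Hilbert-Schmidt class: all compact operators $T$ on $\mathcal{K}$ with $\sum_j\|Te_j\|^2<\infty$, where $\{e_j\}$ is an orthonormal basis of $\mathcal{K}$; it is a Hilbert space with inner product $[T,S]_{\mathrm{tr}}=\mathrm{trace}(S^*T)=\sum_j\langle Te_j,Se_j\rangle$ and norm $\|T\|_2=[T,T]_{\mathrm{tr}}^{1/2}$. For a bounded linear operator $G:\mathcal{H}\to\mathcal{C}_2(\mathcal{K})$, the adjoint $G^*:\mathcal{C}_2(\mathcal{K})\to\mathcal{H}$ is determined by $[Gx,T]_{\mathrm{tr}}=\langle x,G^*T\rangle$ for all $x\in\mathcal{H}$, $T\in\mathcal{C}_2(\mathcal{K})$. A family $\{G_i\}_{i\in I}$ of bounded linear operators from $\mathcal{H}$ into $\mathcal{C}_2(\mathcal{K})$ is a Hilbert-Schmidt frame (HS-frame) for $\mathcal{H}$ with respect to $\mathcal{K}$ with (frame) bounds $A,B$ if $A,B>0$ and $$A\|x\|^2\leq\sum_{i\in I}\|G_ix\|_2^2\leq B\|x\|^2\quad\text{for all }x\in\mathcal{H};$$ $A$ is the lower and $B$ the upper frame bound (bounds are not required to be optimal). The scalar $A$ (a frame bound) is unrelated to the operators $A_i\in\mathcal{C}_2(\mathcal{K})$. *)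

theory Defs
  imports "HOL-Analysis.Analysis"
begin

text \<open>
  Complex inner product spaces. The inner product is linear in the first and conjugate linear
  in the second argument. The last axiom contains positive definiteness, and it ties the inner
  product to the norm (hence to the topology).
\<close>

class complex_inner = real_normed_vector +
  fixes scaleC :: "complex \<Rightarrow> 'a \<Rightarrow> 'a"  (infixr "*\<^sub>C" 75)
    and cinner :: "'a \<Rightarrow> 'a \<Rightarrow> complex"
  assumes scaleC_add_right: "a *\<^sub>C (x + y) = a *\<^sub>C x + a *\<^sub>C y"
    and scaleC_add_left: "(a + b) *\<^sub>C x = a *\<^sub>C x + b *\<^sub>C x"
    and scaleC_scaleC: "a *\<^sub>C b *\<^sub>C x = (a * b) *\<^sub>C x"
    and scaleC_of_real: "complex_of_real r *\<^sub>C x = r *\<^sub>R x"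
    and cinner_commute: "cinner x y = cnj (cinner y x)"
    and cinner_add_left: "cinner (x + y) z = cinner x z + cinner y z"
    and cinner_scaleC_left: "cinner (a *\<^sub>C x) y = a * cinner x y"
    and cinner_self: "cinner x x = complex_of_real ((norm x)\<^sup>2)"

class chilbert_space = complex_inner + complete_space

lemma vector_space_scaleC: "vector_space (scaleC :: complex \<Rightarrow> 'a::complex_inner \<Rightarrow> 'a)"
proof
  show "1 *\<^sub>C x = x" for x :: 'a
    using scaleC_of_real [of 1 x] by simp
qed (simp_all add: scaleC_add_right scaleC_add_left scaleC_scaleC)

definition orthonormal_basis :: "'a::complex_inner set \<Rightarrow> bool" where
  "orthonormal_basis E \<longleftrightarrow>
     (\<forall>e\<in>E. norm e = 1) \<and> (\<forall>e\<in>E. \<forall>f\<in>E. e \<noteq> f \<longrightarrow> cinner e f = 0) \<and>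
     closure (module.span scaleC E) = UNIV"

text \<open>Relative compactness of the image of the unit ball also yields boundedness.\<close>

definition compact_operator :: "('a::complex_inner \<Rightarrow> 'b::complex_inner) \<Rightarrow> bool" where
  "compact_operator T \<longleftrightarrow>
     Vector_Spaces.linear scaleC scaleC T \<and> compact (closure (T ` cball 0 1))"

text \<open>
  The Hilbert-Schmidt class, its inner product and its norm, computed with an orthonormal
  basis \<open>E\<close>. None of them depends on the choice of \<open>E\<close>; statements fix an arbitrary
  orthonormal basis.
\<close>

definition hs_class :: "'k::complex_inner set \<Rightarrow> ('k \<Rightarrow> 'k) set" where
  "hs_class E = {T. compact_operator T \<and> (\<lambda>e. (norm (T e))\<^sup>2) summable_on E}"

definition hs_inner :: "'k::complex_inner set \<Rightarrow> ('k \<Rightarrow> 'k) \<Rightarrow> ('k \<Rightarrow> 'k) \<Rightarrow> complex" where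
  "hs_inner E T S = (\<Sum>\<^sub>\<infinity>e\<in>E. cinner (T e) (S e))"

definition hs_norm :: "'k::complex_inner set \<Rightarrow> ('k \<Rightarrow> 'k) \<Rightarrow> real" where
  "hs_norm E T = sqrt (Re (hs_inner E T T))"

text \<open>Bounded linear operators into the Hilbert-Schmidt class, with its pointwise vector space structure.\<close>

definition bounded_operator_into_hs ::
  "'k::complex_inner set \<Rightarrow> ('h::complex_inner \<Rightarrow> 'k \<Rightarrow> 'k) \<Rightarrow> bool" where
  "bounded_operator_into_hs E G \<longleftrightarrow>
     (\<forall>x. G x \<in> hs_class E) \<and>
     (\<forall>x y. G (x + y) = (\<lambda>v. G x v + G y v)) \<and>
     (\<forall>a x. G (a *\<^sub>C x) = (\<lambda>v. a *\<^sub>C G x v)) \<and>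
     (\<exists>C. \<forall>x. hs_norm E (G x) \<le> C * norm x)"

text \<open>
  For \<open>G\<close> a bounded operator from a Hilbert space into the Hilbert-Schmidt class and \<open>T\<close> in
  that class, the defining vector exists (Riesz) and is unique.
\<close>

definition hs_adjoint ::
  "'k::complex_inner set \<Rightarrow> ('h::complex_inner \<Rightarrow> 'k \<Rightarrow> 'k) \<Rightarrow> ('k \<Rightarrow> 'k) \<Rightarrow> 'h" where
  "hs_adjoint E G T = (THE y. \<forall>x. hs_inner E (G x) T = cinner x y)"

definition hs_frame ::
  "'k::complex_inner set \<Rightarrow> 'i set \<Rightarrow> ('i \<Rightarrow> 'h::complex_inner \<Rightarrow> 'k \<Rightarrow> 'k) \<Rightarrow> real \<Rightarrow> real \<Rightarrow> bool" where
  "hs_frame E I G A B \<longleftrightarrow>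
     A > 0 \<and> B > 0 \<and> (\<forall>i\<in>I. bounded_operator_into_hs E (G i)) \<and>
     (\<forall>x. (\<lambda>i. (hs_norm E (G i x))\<^sup>2) summable_on I \<and>
          A * (norm x)\<^sup>2 \<le> (\<Sum>\<^sub>\<infinity>i\<in>I. (hs_norm E (G i x))\<^sup>2) \<and>
          (\<Sum>\<^sub>\<infinity>i\<in>I. (hs_norm E (G i x))\<^sup>2) \<le> B * (norm x)\<^sup>2)"

end

theory Submission
  imports Defs
begin

text \<open>
  Write \<open>p = lam + \<mu> \<epsilon>\<close> and \<open>q = \<nu> + \<mu> / (4 \<epsilon>)\<close>, both below \<open>1\<close>. By the weighted
  arithmetic-geometric mean inequality the mixed term of the hypothesis splits, and the synthesis
  vectors \<open>u = \<Sum> G\<^sub>i* T\<^sub>i\<close> and \<open>w = \<Sum> H\<^sub>i* T\<^sub>i\<close> of every finite family satisfy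
  \<open>\<parallel>u - w\<parallel>\<^sup>2 \<le> p \<parallel>u\<parallel>\<^sup>2 + q \<parallel>w\<parallel>\<^sup>2\<close>. Two consequences of this single inequality carry the proof.

  The triangle inequality makes the norms of \<open>u\<close> and \<open>w\<close> comparable, so the Bessel bound of \<open>G\<close>
  passes to \<open>H\<close>: for \<open>T\<^sub>i = H\<^sub>i x\<close> the sum of the \<open>\<parallel>H\<^sub>i x\<parallel>\<^sup>2\<close> is the inner product of \<open>x\<close> with
  \<open>w\<close>, and \<open>\<parallel>u\<parallel>\<close> is controlled by the square root of the same sum
  (\<open>bessel_of_synthesis_comparison\<close>). This is the upper bound.

  For the lower bound, put \<open>S z = \<Sum> G\<^sub>i* G\<^sub>i z\<close> and \<open>M z = \<Sum> H\<^sub>i* G\<^sub>i z\<close>. Since both families are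
  Bessel, these sums converge in norm, and the inequality passes to the limit:
  \<open>\<parallel>S z - M z\<parallel>\<^sup>2 \<le> p \<parallel>S z\<parallel>\<^sup>2 + q \<parallel>M z\<parallel>\<^sup>2\<close>. Expanding the left-hand side gives
  \<open>(1 - p) \<parallel>S z\<parallel>\<^sup>2 + (1 - q) \<parallel>M z\<parallel>\<^sup>2 \<le> 2 Re \<langle>S z, M z\<rangle>\<close>, that is, \<open>M\<close> is accretive relative to \<open>S\<close>.
  Accretivity forces surjectivity (\<open>accretive_pair_surj\<close>, an application of the contraction
  principle); this is used once to see that the frame operator \<open>S\<close> is onto and once more to see
  that \<open>M\<close> is onto. If \<open>x = M z\<close>, then \<open>\<parallel>x\<parallel>\<^sup>2 = \<langle>x, M z\<rangle>\<close> is a pairing of the families \<open>H\<^sub>i x\<close> and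
  \<open>G\<^sub>i z\<close>. By the Cauchy-Schwarz inequality its square is at most the sum of the \<open>\<parallel>H\<^sub>i x\<parallel>\<^sup>2\<close> times
  \<open>\<langle>z, S z\<rangle> \<le> \<parallel>S z\<parallel>\<^sup>2 / A\<close>, and \<open>\<parallel>S z\<parallel>\<close> is comparable to \<open>\<parallel>M z\<parallel> = \<parallel>x\<parallel>\<close>
  (\<open>perturbed_frame_lower_bound\<close>).

  The frame estimates use only the real part of the inner product. The adjoint of an operator into the
  Hilbert-Schmidt class is given by a definite description, so its existence is first derived
  from the Riesz representation theorem.
\<close>

section \<open>Real geometry of complex inner product spaces\<close>

definition rinner :: "'a::complex_inner \<Rightarrow> 'a \<Rightarrow> real" where
  "rinner x y = Re (cinner x y)"

instance chilbert_space \<subseteq> banach ..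

lemma rinner_commute: "rinner x y = rinner y x"
  unfolding rinner_def by (subst cinner_commute) simp

lemma rinner_add_left: "rinner (x + y) z = rinner x z + rinner y z"
  by (simp add: rinner_def cinner_add_left)

lemma rinner_add_right: "rinner z (x + y) = rinner z x + rinner z y"
  by (metis rinner_add_left rinner_commute)

lemma rinner_scaleR_left: "rinner (r *\<^sub>R x) y = r * rinner x y"
  unfolding rinner_def by (simp flip: scaleC_of_real add: cinner_scaleC_left)

lemma rinner_scaleR_right: "rinner y (r *\<^sub>R x) = r * rinner y x"
  by (metis rinner_scaleR_left rinner_commute)

lemma rinner_self: "rinner x x = (norm x)\<^sup>2"
  by (simp add: rinner_def cinner_self)

lemma rinner_diff_left: "rinner (x - y) z = rinner x z - rinner y z"
  using rinner_add_left [of x "(-1) *\<^sub>R y" z] by (simp only: rinner_scaleR_left) simp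

lemma rinner_diff_right: "rinner z (x - y) = rinner z x - rinner z y"
  by (metis rinner_diff_left rinner_commute)

lemma norm_add_square: "(norm (x + y))\<^sup>2 = (norm x)\<^sup>2 + 2 * rinner x y + (norm y)\<^sup>2"
  using rinner_commute [of x y]
  by (simp flip: rinner_self add: rinner_add_left rinner_add_right)

lemma norm_diff_square: "(norm (x - y))\<^sup>2 = (norm x)\<^sup>2 - 2 * rinner x y + (norm y)\<^sup>2"
  using rinner_commute [of x y]
  by (simp flip: rinner_self add: rinner_diff_left rinner_diff_right)

text \<open>
  The Cauchy-Schwarz inequality, read off from the nonnegative square norm of
  \<open>\<parallel>y\<parallel> x - \<parallel>x\<parallel> y\<close>.
\<close>

lemma rinner_le: "rinner x y \<le> norm x * norm y"
proof (cases "x = 0 \<or> y = 0")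
  case True
  then show ?thesis
    using rinner_scaleR_left [of 0 x y] rinner_scaleR_right [of x 0 y] by auto
next
  case False
  have "0 \<le> (norm (norm y *\<^sub>R x - norm x *\<^sub>R y))\<^sup>2" by simp
  also have "\<dots> = 2 * (norm x * norm y) * (norm x * norm y - rinner x y)"
    unfolding norm_diff_square rinner_scaleR_left rinner_scaleR_right
    by (simp add: power2_eq_square algebra_simps)
  finally have "0 \<le> (2 * (norm x * norm y)) * (norm x * norm y - rinner x y)" .
  moreover have "0 < 2 * (norm x * norm y)"
    using False by simp
  ultimately show ?thesis
    by (metis diff_ge_0_iff_ge mult_pos_neg not_le)
qed

lemma abs_rinner_le: "\<bar>rinner x y\<bar> \<le> norm x * norm y"
  using rinner_le [of x y] rinner_le [of "(-1) *\<^sub>R x" y]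
  by (simp only: rinner_scaleR_left) simp

lemma bounded_linear_rinner: "bounded_linear (rinner x)"
  by (rule bounded_linear_intro [where K = "norm x"])
     (simp_all add: rinner_add_right rinner_scaleR_right abs_rinner_le mult.commute [of _ "norm x"])

lemma norm_scaleC: "norm (a *\<^sub>C x) = cmod a * norm (x::'a::complex_inner)"
proof -
  have "cinner (a *\<^sub>C x) (a *\<^sub>C x) = a * cnj a * cinner x x"
    by (metis cinner_commute cinner_scaleC_left complex_cnj_mult mult.assoc)
  then have "complex_of_real ((norm (a *\<^sub>C x))\<^sup>2) = complex_of_real ((cmod a * norm x)\<^sup>2)"
    unfolding cinner_self by (simp add: power_mult_distrib flip: complex_norm_square)
  then have "(norm (a *\<^sub>C x))\<^sup>2 = (cmod a * norm x)\<^sup>2"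
    by (simp only: of_real_eq_iff)
  then show ?thesis
    by (simp add: power2_eq_iff_nonneg)
qed

lemma Im_cinner: "Im (cinner x y) = - rinner (\<i> *\<^sub>C x) y"
  by (simp add: rinner_def cinner_scaleC_left)

text \<open>
  Estimating real and imaginary part separately costs a factor of two, which is harmless: the bound
  serves only to make series of inner products absolutely convergent.
\<close>

lemma cmod_cinner_le: "cmod (cinner x y) \<le> 2 * (norm x * norm y)"
proof -
  have "cmod (cinner x y) \<le> \<bar>rinner x y\<bar> + \<bar>rinner (\<i> *\<^sub>C x) y\<bar>"
    using cmod_le [of "cinner x y"] by (simp add: Im_cinner rinner_def)
  then show ?thesis
    using abs_rinner_le [of x y] abs_rinner_le [of "\<i> *\<^sub>C x" y] by (simp add: norm_scaleC)
qed

lemma rinner_eqI: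
  assumes "\<And>x. rinner x y = rinner x z"
  shows "y = z"
  using assms [of "y - z"] rinner_self [of "y - z"] by (simp add: rinner_diff_right)

text \<open>
  The representing vector is the minimiser of \<open>\<phi> x = \<parallel>x\<parallel>\<^sup>2 - 2 f x\<close>, which equals
  \<open>\<parallel>x - y\<parallel>\<^sup>2 - \<parallel>y\<parallel>\<^sup>2\<close> if \<open>f = rinner y\<close>. The parallelogram law makes every minimising sequence a
  Cauchy sequence, and the first-order condition at the limit \<open>y\<close> says \<open>f x = rinner x y\<close>.
\<close>

lemma Riesz_real:
  fixes f :: "'h::chilbert_space \<Rightarrow> real"
  assumes "bounded_linear f"
  shows "\<exists>y. \<forall>x. f x = rinner x y"
proof -
  interpret f: bounded_linear f by fact
  define \<phi> where "\<phi> x = (norm x)\<^sup>2 - 2 * f x" for x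
  define m where "m = Inf (range \<phi>)"
  obtain C where C: "\<And>x. norm (f x) \<le> norm x * C"
    using f.bounded by blast
  have "\<phi> x \<ge> - C\<^sup>2" for x
  proof -
    have "0 \<le> (norm x - C)\<^sup>2" by simp
    then show ?thesis
      using C [of x] unfolding \<phi>_def real_norm_def abs_le_iff power2_diff by (simp add: algebra_simps)
  qed
  then have bdd: "bdd_below (range \<phi>)"
    by (intro bdd_belowI2)
  then have m_le: "m \<le> \<phi> x" for x
    unfolding m_def by (rule cINF_lower) simp
  \<comment> \<open>The parallelogram law, with the infimum as a lower bound for the value at the midpoint.\<close>
  have close: "(norm (x - y))\<^sup>2 \<le> 2 * (\<phi> x + \<phi> y - 2 * m)" for x y
    using m_le [of "(1/2) *\<^sub>R (x + y)"]
    by (simp add: \<phi>_def f.scaleR f.add norm_diff_square power_divide norm_add_square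
        del: scaleR_right_distrib) (simp add: field_simps)
  have "\<exists>x. \<phi> x < m + 1 / real (Suc n)" for n
    using cInf_lessD [of "range \<phi>" "m + 1 / real (Suc n)"] by (auto simp: m_def)
  then obtain s where s: "\<And>n. \<phi> (s n) < m + 1 / real (Suc n)"
    by metis
  have "Cauchy s"
  proof (rule metric_CauchyI)
    fix e :: real assume "e > 0"
    obtain N where N: "inverse (real (Suc N)) < e\<^sup>2 / 4"
      using reals_Archimedean [of "e\<^sup>2 / 4"] \<open>e > 0\<close> by auto
    have *: "\<phi> (s n) < m + e\<^sup>2 / 4" if "n \<ge> N" for n
    proof -
      have "1 / real (Suc n) \<le> inverse (real (Suc N))"
        using that by (simp add: field_simps)
      then show ?thesis using s [of n] N by linarith
    qed
    show "\<exists>M. \<forall>p\<ge>M. \<forall>n\<ge>M. dist (s p) (s n) < e"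
    proof (intro exI allI impI)
      fix p n assume "p \<ge> N" "n \<ge> N"
      then have "(norm (s p - s n))\<^sup>2 < e\<^sup>2"
        using close [of "s p" "s n"] * [of p] * [of n] by simp
      then show "dist (s p) (s n) < e"
        unfolding dist_norm by (rule power2_less_imp_less) (use \<open>e > 0\<close> in simp)
    qed
  qed
  then obtain y where y: "s \<longlonglongrightarrow> y"
    using Cauchy_convergent convergent_def by blast
  have "(\<lambda>n. \<phi> (s n)) \<longlonglongrightarrow> \<phi> y"
    unfolding \<phi>_def by (intro tendsto_intros y f.tendsto)
  moreover have "(\<lambda>n. m + 1 / real (Suc n)) \<longlonglongrightarrow> m"
    using tendsto_add [OF tendsto_const LIMSEQ_inverse_real_of_nat, of m] by (simp add: inverse_eq_divide)
  ultimately have "\<phi> y \<le> m"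
    by (rule LIMSEQ_le) (use s less_imp_le in blast)
  have "f x = rinner x y" for x
  proof -
    define d where "d = f x - rinner x y"
    define n where "n = (norm x)\<^sup>2"
    \<comment> \<open>The denominator exceeds the second-order coefficient \<open>n\<close>, so the step \<open>t\<close> would lower \<open>\<phi>\<close> if \<open>d \<noteq> 0\<close>.\<close>
    define t where "t = d / (n + 1)"
    have n: "n \<ge> 0" by (simp add: n_def)
    have "\<phi> (y + t *\<^sub>R x) = \<phi> y - 2 * t * d + t\<^sup>2 * n"
      by (simp add: \<phi>_def norm_add_square f.add f.scaleR rinner_scaleR_right d_def n_def
          rinner_commute [of x y] power_mult_distrib algebra_simps)
    then have "2 * t * d \<le> t\<^sup>2 * n"
      using m_le [of "y + t *\<^sub>R x"] \<open>\<phi> y \<le> m\<close> by simp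
    moreover have "d = t * (n + 1)"
      using n by (simp add: t_def)
    ultimately have "t\<^sup>2 * (n + 2) \<le> 0"
      by (simp add: power2_eq_square algebra_simps)
    then have "t = 0"
      using n by (simp add: mult_le_0_iff)
    then show ?thesis
      using \<open>d = t * (n + 1)\<close> by (simp add: d_def)
  qed
  then show ?thesis by blast
qed

text \<open>
  A complex-linear functional is determined by its real part, since
  \<open>Im (f x) = - Re (f (\<i> x))\<close>; so the vector that represents the real part represents \<open>f\<close>.
\<close>

lemma Riesz_representation:
  fixes f :: "'h::chilbert_space \<Rightarrow> complex"
  assumes add: "\<And>x y. f (x + y) = f x + f y"
    and scale: "\<And>a x. f (a *\<^sub>C x) = a * f x"
    and bound: "\<And>x. \<bar>Re (f x)\<bar> \<le> C * norm x"
  shows "\<exists>y. \<forall>x. f x = cinner x y"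
proof -
  have "bounded_linear (\<lambda>x. Re (f x))"
  proof (rule bounded_linear_intro [where K = C])
    show "Re (f (r *\<^sub>R x)) = r *\<^sub>R Re (f x)" for r x
      using scale [of "complex_of_real r" x] by (simp add: scaleC_of_real)
  qed (use bound in \<open>simp_all add: add mult.commute\<close>)
  then obtain y where y: "\<And>x. Re (f x) = rinner x y"
    using Riesz_real by blast
  have "f x = cinner x y" for x
    using y [of x] y [of "\<i> *\<^sub>C x"]
    by (simp add: complex_eq_iff Im_cinner scale) (simp add: rinner_def)
  then show ?thesis by blast
qed

section \<open>Surjectivity of accretive operators\<close>

text \<open>
  The assumption \<open>accr\<close> makes \<open>S z - b M z\<close> shorter than \<open>S z\<close> by a fixed factor below \<open>1\<close>. Hence
  \<open>v \<mapsto> v - b (M z - x)\<close>, where \<open>S z = v\<close>, is a contraction, and a fixed point of it solves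
  \<open>M z = x\<close>. With \<open>S = id\<close> this is the surjectivity of a coercive operator. Working with a pair of
  maps yields the surjectivity of \<open>M\<close> without inverting \<open>S\<close>: any choice of preimages will do.
\<close>

lemma accretive_pair_surj:
  fixes S M :: "'a \<Rightarrow> 'h::chilbert_space"
  assumes surj: "surj S"
    and diffS: "\<And>x y. \<exists>z. S z = S x - S y \<and> M z = M x - M y"
    and a: "a > 0" and b: "b > 0"
    and accr: "\<And>z. a * (norm (S z))\<^sup>2 + b * (norm (M z))\<^sup>2 \<le> 2 * rinner (S z) (M z)"
  shows "surj M"
proof -
  \<comment> \<open>The truncation at \<open>0\<close> covers \<open>a b > 1\<close>, which is possible only if \<open>S\<close> vanishes identically.\<close>
  define q where "q = sqrt (max 0 (1 - a * b))"
  have q: "0 \<le> q" "q < 1"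
    using a b by (auto simp: q_def)
  have contr: "norm (S z - b *\<^sub>R M z) \<le> q * norm (S z)" for z
  proof -
    have "(norm (S z - b *\<^sub>R M z))\<^sup>2 = (norm (S z))\<^sup>2 - b * (2 * rinner (S z) (M z)) + b\<^sup>2 * (norm (M z))\<^sup>2"
      by (simp add: norm_diff_square rinner_scaleR_right power_mult_distrib)
    also have "\<dots> \<le> (norm (S z))\<^sup>2 - b * (a * (norm (S z))\<^sup>2 + b * (norm (M z))\<^sup>2) + b\<^sup>2 * (norm (M z))\<^sup>2"
      using mult_left_mono [OF accr, of b z] b by simp
    also have "\<dots> = (1 - a * b) * (norm (S z))\<^sup>2"
      by (simp add: algebra_simps power2_eq_square)
    also have "\<dots> \<le> max 0 (1 - a * b) * (norm (S z))\<^sup>2"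
      by (intro mult_right_mono) auto
    also have "\<dots> = (q * norm (S z))\<^sup>2"
      by (simp add: q_def power_mult_distrib)
    finally show ?thesis
      by (rule power2_le_imp_le) (use q in simp)
  qed
  define R where "R v = (SOME z. S z = v)" for v
  have R: "S (R v) = v" for v
    unfolding R_def by (rule someI_ex) (use surj in \<open>metis surjD\<close>)
  have "\<exists>z. M z = x" for x
  proof -
    define \<Psi> where "\<Psi> v = v - b *\<^sub>R (M (R v) - x)" for v
    have "dist (\<Psi> v) (\<Psi> w) \<le> q * dist v w" for v w
    proof -
      obtain z where z: "S z = v - w" "M z = M (R v) - M (R w)"
        using diffS [of "R v" "R w"] by (auto simp: R)
      have "\<Psi> v - \<Psi> w = S z - b *\<^sub>R M z"
        by (simp add: \<Psi>_def z algebra_simps)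
      then show ?thesis
        using contr [of z] by (simp add: dist_norm z)
    qed
    then obtain v where "\<Psi> v = v"
      using banach_fix_type [OF q, of \<Psi>] by blast
    then have "M (R v) = x"
      using b by (simp add: \<Psi>_def)
    then show ?thesis by blast
  qed
  then show ?thesis
    unfolding surj_def by metis
qed

section \<open>Hilbert-Schmidt operators\<close>

lemma hs_class_summable: "T \<in> hs_class E \<Longrightarrow> (\<lambda>e. (norm (T e))\<^sup>2) summable_on E"
  by (simp add: hs_class_def)

lemma hs_norm_eq_sqrt_infsum:
  assumes "T \<in> hs_class E"
  shows "hs_norm E T = sqrt (\<Sum>\<^sub>\<infinity>e\<in>E. (norm (T e))\<^sup>2)"
proof -
  have "((\<lambda>e. complex_of_real ((norm (T e))\<^sup>2)) has_sum
           complex_of_real (\<Sum>\<^sub>\<infinity>e\<in>E. (norm (T e))\<^sup>2)) E"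
    by (rule has_sum_of_real) (use hs_class_summable [OF assms] in simp)
  then show ?thesis
    unfolding hs_norm_def hs_inner_def cinner_self by (simp only: infsumI Re_complex_of_real)
qed

lemma hs_norm_nonneg: "T \<in> hs_class E \<Longrightarrow> 0 \<le> hs_norm E T"
  by (simp add: hs_norm_eq_sqrt_infsum infsum_nonneg)

lemma Re_hs_inner_self: "T \<in> hs_class E \<Longrightarrow> Re (hs_inner E T T) = (hs_norm E T)\<^sup>2"
  using hs_norm_nonneg [of T E] by (simp add: hs_norm_def)

text \<open>
  The Cauchy-Schwarz inequality for the square-summable families \<open>\<parallel>T e\<parallel>\<close> and \<open>\<parallel>S e\<parallel>\<close>, obtained from
  its finite version by passing to the supremum over finite subsets of \<open>E\<close>.
\<close>

lemma hs_norms_product: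
  assumes T: "T \<in> hs_class E" and S: "S \<in> hs_class E"
  shows "(\<lambda>e. norm (T e) * norm (S e)) summable_on E"
    and "(\<Sum>\<^sub>\<infinity>e\<in>E. norm (T e) * norm (S e)) \<le> hs_norm E T * hs_norm E S"
proof -
  have L2: "L2_set (\<lambda>e. norm (R e)) F \<le> hs_norm E R"
    if "R \<in> hs_class E" "finite F" "F \<subseteq> E" for R and F
    using that finite_sum_le_infsum [OF hs_class_summable [of R E]]
    by (simp add: L2_set_def hs_norm_eq_sqrt_infsum)
  have fin: "(\<Sum>e\<in>F. norm (T e) * norm (S e)) \<le> hs_norm E T * hs_norm E S"
    if F: "finite F" "F \<subseteq> E" for F
  proof -
    have "(\<Sum>e\<in>F. norm (T e) * norm (S e)) \<le> L2_set (\<lambda>e. norm (T e)) F * L2_set (\<lambda>e. norm (S e)) F"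
      using L2_set_mult_ineq [of "\<lambda>e. norm (T e)" "\<lambda>e. norm (S e)" F] by simp
    also have "\<dots> \<le> hs_norm E T * hs_norm E S"
      by (intro mult_mono L2 T S F L2_set_nonneg hs_norm_nonneg)
    finally show ?thesis .
  qed
  show "(\<lambda>e. norm (T e) * norm (S e)) summable_on E"
    by (rule nonneg_bdd_above_summable_on) (auto intro: bdd_aboveI2 fin)
  then show "(\<Sum>\<^sub>\<infinity>e\<in>E. norm (T e) * norm (S e)) \<le> hs_norm E T * hs_norm E S"
    by (rule infsum_le_finite_sums) (rule fin)
qed

lemma has_sum_hs_inner:
  assumes T: "T \<in> hs_class E" and S: "S \<in> hs_class E"
  shows "((\<lambda>e. cinner (T e) (S e)) has_sum hs_inner E T S) E"
proof -
  have "(\<lambda>e. 2 * (norm (T e) * norm (S e))) summable_on E"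
    by (intro summable_on_cmult_right hs_norms_product T S)
  then have "(\<lambda>e. norm (cinner (T e) (S e))) summable_on E"
    by (rule summable_on_comparison_test) (simp_all add: cmod_cinner_le)
  then show ?thesis
    unfolding hs_inner_def by (rule has_sum_infsum [OF abs_summable_summable])
qed

lemma abs_Re_hs_inner_le:
  assumes T: "T \<in> hs_class E" and S: "S \<in> hs_class E"
  shows "\<bar>Re (hs_inner E T S)\<bar> \<le> hs_norm E T * hs_norm E S"
proof -
  let ?p = "\<lambda>e. norm (T e) * norm (S e)"
  have re: "((\<lambda>e. rinner (T e) (S e)) has_sum Re (hs_inner E T S)) E"
    unfolding rinner_def by (intro has_sum_Re has_sum_hs_inner T S)
  have p: "(?p has_sum infsum ?p E) E"
    by (intro has_sum_infsum hs_norms_product T S)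
  have "Re (hs_inner E T S) \<le> infsum ?p E"
    by (rule has_sum_mono [OF re p]) (rule rinner_le)
  moreover have "- Re (hs_inner E T S) \<le> infsum ?p E"
    by (rule has_sum_mono [OF has_sum_uminusI [OF re] p]) (use abs_rinner_le abs_le_D2 in blast)
  ultimately show ?thesis
    using hs_norms_product(2) [OF T S] by linarith
qed

lemma hs_inner_commute: "hs_inner E T S = cnj (hs_inner E S T)"
proof -
  have "(\<lambda>e. cinner (T e) (S e)) = (\<lambda>e. cnj (cinner (S e) (T e)))"
    by (rule ext) (rule cinner_commute)
  then show ?thesis
    by (simp only: hs_inner_def infsum_cnj)
qed

lemma hs_inner_add_left:
  assumes "T \<in> hs_class E" "T' \<in> hs_class E" "S \<in> hs_class E"
  shows "hs_inner E (\<lambda>v. T v + T' v) S = hs_inner E T S + hs_inner E T' S"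
proof -
  have "((\<lambda>e. cinner (T e + T' e) (S e)) has_sum (hs_inner E T S + hs_inner E T' S)) E"
    unfolding cinner_add_left by (intro has_sum_add has_sum_hs_inner assms)
  then show ?thesis
    unfolding hs_inner_def [of E "\<lambda>v. T v + T' v"] by (rule infsumI)
qed

lemma hs_inner_scaleC_left: "hs_inner E (\<lambda>v. a *\<^sub>C T v) S = a * hs_inner E T S"
  by (simp add: hs_inner_def cinner_scaleC_left infsum_cmult_right')

lemma hs_inner_add_right:
  assumes "T \<in> hs_class E" "T' \<in> hs_class E" "S \<in> hs_class E"
  shows "hs_inner E S (\<lambda>v. T v + T' v) = hs_inner E S T + hs_inner E S T'"
  unfolding hs_inner_commute [of E S] hs_inner_add_left [OF assms] by simp

text \<open>
  The Riesz representation theorem applied to \<open>x \<mapsto> [G x, T]\<close> supplies the vector that the definition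
  of \<open>hs_adjoint\<close> describes; from here on only this characterisation of the adjoint matters.
\<close>

lemma cinner_hs_adjoint:
  fixes G :: "'h::chilbert_space \<Rightarrow> 'k::complex_inner \<Rightarrow> 'k"
  assumes G: "bounded_operator_into_hs E G" and T: "T \<in> hs_class E"
  shows "hs_inner E (G x) T = cinner x (hs_adjoint E G T)"
proof -
  obtain C where C: "\<And>x. hs_norm E (G x) \<le> C * norm x"
    using G by (auto simp: bounded_operator_into_hs_def)
  have Gx: "G x \<in> hs_class E" for x
    using G by (simp add: bounded_operator_into_hs_def)
  have "\<exists>y. \<forall>x. hs_inner E (G x) T = cinner x y"
  proof (rule Riesz_representation)
    show "\<bar>Re (hs_inner E (G x) T)\<bar> \<le> (C * hs_norm E T) * norm x" for x
      using abs_Re_hs_inner_le [OF Gx [of x] T] mult_right_mono [OF C [of x] hs_norm_nonneg [OF T]]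
      by (simp add: mult_ac)
  qed (use G Gx T in \<open>simp_all add: bounded_operator_into_hs_def hs_inner_add_left hs_inner_scaleC_left\<close>)
  then have "\<exists>!y. \<forall>x. hs_inner E (G x) T = cinner x y"
  proof (rule ex_ex1I)
    fix y z
    assume "\<forall>x. hs_inner E (G x) T = cinner x y" "\<forall>x. hs_inner E (G x) T = cinner x z"
    then show "y = z"
      by (intro rinner_eqI) (simp add: rinner_def)
  qed
  from theI' [OF this] show ?thesis
    unfolding hs_adjoint_def by (rule spec)
qed

lemma rinner_hs_adjoint:
  fixes G :: "'h::chilbert_space \<Rightarrow> 'k::complex_inner \<Rightarrow> 'k"
  assumes "bounded_operator_into_hs E G" and "T \<in> hs_class E"
  shows "rinner x (hs_adjoint E G T) = Re (hs_inner E (G x) T)"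
  by (simp add: rinner_def cinner_hs_adjoint [OF assms])

lemma bounded_operator_into_hs_diff:
  assumes "bounded_operator_into_hs E G"
  shows "G x = (\<lambda>v. G (x - y) v + G y v)"
proof -
  have "G ((x - y) + y) = (\<lambda>v. G (x - y) v + G y v)"
    using assms unfolding bounded_operator_into_hs_def by blast
  then show ?thesis by simp
qed

lemma bounded_operator_into_hs_class: "bounded_operator_into_hs E G \<Longrightarrow> G x \<in> hs_class E"
  by (simp add: bounded_operator_into_hs_def)

lemma hs_adjoint_apply_diff:
  fixes F G :: "'h::chilbert_space \<Rightarrow> 'k::complex_inner \<Rightarrow> 'k"
  assumes F: "bounded_operator_into_hs E F" and G: "bounded_operator_into_hs E G"
  shows "hs_adjoint E F (G (x - y)) = hs_adjoint E F (G x) - hs_adjoint E F (G y)"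
proof (rule rinner_eqI)
  fix z
  note cls = bounded_operator_into_hs_class
  have "hs_inner E (F z) (G x) = hs_inner E (F z) (G (x - y)) + hs_inner E (F z) (G y)"
    by (subst bounded_operator_into_hs_diff [OF G, of x y]) (intro hs_inner_add_right cls F G)
  then show "rinner z (hs_adjoint E F (G (x - y))) = rinner z (hs_adjoint E F (G x) - hs_adjoint E F (G y))"
    by (simp add: rinner_diff_right rinner_hs_adjoint F G cls)
qed

section \<open>Bessel families\<close>

text \<open>
  The upper half of the frame condition. It is isolated because it has to be established for the
  perturbed family before the operators that give the lower bound can be formed.
\<close>

definition hs_bessel ::
  "'k::complex_inner set \<Rightarrow> 'i set \<Rightarrow> ('i \<Rightarrow> 'h::complex_inner \<Rightarrow> 'k \<Rightarrow> 'k) \<Rightarrow> real \<Rightarrow> bool" where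
  "hs_bessel E I G B \<longleftrightarrow>
     (\<forall>i\<in>I. bounded_operator_into_hs E (G i)) \<and>
     (\<forall>x. (\<lambda>i. (hs_norm E (G i x))\<^sup>2) summable_on I \<and>
          (\<Sum>\<^sub>\<infinity>i\<in>I. (hs_norm E (G i x))\<^sup>2) \<le> B * (norm x)\<^sup>2)"

lemma hs_frame_iff_bessel:
  "hs_frame E I G A B \<longleftrightarrow>
     A > 0 \<and> B > 0 \<and> hs_bessel E I G B \<and>
     (\<forall>x. A * (norm x)\<^sup>2 \<le> (\<Sum>\<^sub>\<infinity>i\<in>I. (hs_norm E (G i x))\<^sup>2))"
  by (auto simp: hs_frame_def hs_bessel_def)

lemma hs_bessel_finite_sum:
  assumes "hs_bessel E I G B" "finite J" "J \<subseteq> I"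
  shows "(\<Sum>i\<in>J. (hs_norm E (G i x))\<^sup>2) \<le> B * (norm x)\<^sup>2"
  using assms finite_sum_le_infsum [of "\<lambda>i. (hs_norm E (G i x))\<^sup>2" I J]
  unfolding hs_bessel_def by (meson order_trans zero_le_power2)

lemma rinner_sum_right: "rinner x (sum f J) = (\<Sum>i\<in>J. rinner x (f i))"
  using linear_sum [OF bounded_linear.linear [OF bounded_linear_rinner]] .

text \<open>
  The adjoint turns the inner product with a synthesis vector into a sum of Hilbert-Schmidt inner
  products; the Cauchy-Schwarz inequality is then used twice, in the Hilbert-Schmidt class and over
  \<open>J\<close>.
\<close>

lemma synthesis_pairing_bound:
  fixes H :: "'i \<Rightarrow> 'h::chilbert_space \<Rightarrow> 'k::complex_inner \<Rightarrow> 'k"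
  assumes H: "\<And>i. i \<in> J \<Longrightarrow> bounded_operator_into_hs E (H i)"
    and T: "\<And>i. i \<in> J \<Longrightarrow> T i \<in> hs_class E"
  shows "(rinner x (\<Sum>i\<in>J. hs_adjoint E (H i) (T i)))\<^sup>2
           \<le> (\<Sum>i\<in>J. (hs_norm E (H i x))\<^sup>2) * (\<Sum>i\<in>J. (hs_norm E (T i))\<^sup>2)"
proof -
  have "\<bar>rinner x (\<Sum>i\<in>J. hs_adjoint E (H i) (T i))\<bar> \<le> (\<Sum>i\<in>J. \<bar>Re (hs_inner E (H i x) (T i))\<bar>)"
    using H T by (simp add: rinner_sum_right rinner_hs_adjoint)
  also have "\<dots> \<le> (\<Sum>i\<in>J. hs_norm E (H i x) * hs_norm E (T i))"
    using H T by (intro sum_mono abs_Re_hs_inner_le) (auto intro: bounded_operator_into_hs_class)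
  finally have "(rinner x (\<Sum>i\<in>J. hs_adjoint E (H i) (T i)))\<^sup>2
                  \<le> (\<Sum>i\<in>J. hs_norm E (H i x) * hs_norm E (T i))\<^sup>2"
    using power_mono [OF _ abs_ge_zero, of "rinner x (\<Sum>i\<in>J. hs_adjoint E (H i) (T i))" _ 2]
    by simp
  also have "\<dots> \<le> (\<Sum>i\<in>J. (hs_norm E (H i x))\<^sup>2) * (\<Sum>i\<in>J. (hs_norm E (T i))\<^sup>2)"
    by (rule Cauchy_Schwarz_ineq_sum)
  finally show ?thesis .
qed

text \<open>
  Duality between analysis and synthesis: the synthesis vector \<open>u\<close> is paired with itself, and the
  Bessel bound at \<open>u\<close> allows one factor \<open>\<parallel>u\<parallel>\<^sup>2\<close> to be cancelled.
\<close>

lemma synthesis_bound: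
  fixes G :: "'i \<Rightarrow> 'h::chilbert_space \<Rightarrow> 'k::complex_inner \<Rightarrow> 'k"
  assumes G: "hs_bessel E I G B" and B: "B \<ge> 0"
    and J: "finite J" "J \<subseteq> I" and T: "\<And>i. i \<in> J \<Longrightarrow> T i \<in> hs_class E"
  shows "(norm (\<Sum>i\<in>J. hs_adjoint E (G i) (T i)))\<^sup>2 \<le> B * (\<Sum>i\<in>J. (hs_norm E (T i))\<^sup>2)"
proof -
  define u where "u = (\<Sum>i\<in>J. hs_adjoint E (G i) (T i))"
  define t where "t = (\<Sum>i\<in>J. (hs_norm E (T i))\<^sup>2)"
  have t: "t \<ge> 0" by (simp add: t_def sum_nonneg)
  have "((norm u)\<^sup>2)\<^sup>2 \<le> (\<Sum>i\<in>J. (hs_norm E (G i u))\<^sup>2) * t"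
    using synthesis_pairing_bound [of J E G T u] G J T
    by (auto simp: hs_bessel_def u_def t_def rinner_self)
  also have "\<dots> \<le> B * (norm u)\<^sup>2 * t"
    by (intro mult_right_mono t hs_bessel_finite_sum [OF G J])
  finally have *: "(norm u)\<^sup>2 * (norm u)\<^sup>2 \<le> (norm u)\<^sup>2 * (B * t)"
    by (simp add: power2_eq_square mult_ac)
  have "(norm u)\<^sup>2 \<le> B * t"
  proof (cases "u = 0")
    case False
    then show ?thesis
      by (intro mult_left_le_imp_le [OF *]) simp
  qed (use t B in simp)
  then show ?thesis
    by (simp only: u_def t_def)
qed

text \<open>
  For \<open>T\<^sub>i = H\<^sub>i x\<close> and \<open>s = \<Sum> \<parallel>H\<^sub>i x\<parallel>\<^sup>2\<close> over a finite set, \<open>s = rinner x w\<close> is at most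
  \<open>\<parallel>x\<parallel> c \<parallel>u\<parallel>\<close>, while the synthesis bound for \<open>G\<close> gives \<open>\<parallel>u\<parallel>\<^sup>2 \<le> B s\<close>. Squaring and cancelling \<open>s\<close>
  leaves a bound that does not depend on the finite set.
\<close>

lemma bessel_of_synthesis_comparison:
  fixes G H :: "'i \<Rightarrow> 'h::chilbert_space \<Rightarrow> 'k::complex_inner \<Rightarrow> 'k"
  assumes G: "hs_bessel E I G B" and B: "B \<ge> 0" and c: "c \<ge> 0"
    and H: "\<And>i. i \<in> I \<Longrightarrow> bounded_operator_into_hs E (H i)"
    and le: "\<And>J T. finite J \<Longrightarrow> J \<subseteq> I \<Longrightarrow> \<forall>i\<in>J. T i \<in> hs_class E \<Longrightarrow>
               norm (\<Sum>i\<in>J. hs_adjoint E (H i) (T i)) \<le> c * norm (\<Sum>i\<in>J. hs_adjoint E (G i) (T i))"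
  shows "hs_bessel E I H (B * c\<^sup>2)"
proof -
  have fin: "(\<Sum>i\<in>J. (hs_norm E (H i x))\<^sup>2) \<le> B * c\<^sup>2 * (norm x)\<^sup>2"
    if J: "finite J" "J \<subseteq> I" for J x
  proof -
    define s where "s = (\<Sum>i\<in>J. (hs_norm E (H i x))\<^sup>2)"
    define w where "w = (\<Sum>i\<in>J. hs_adjoint E (H i) (H i x))"
    define u where "u = (\<Sum>i\<in>J. hs_adjoint E (G i) (H i x))"
    have Hx: "\<forall>i\<in>J. H i x \<in> hs_class E"
      using H J by (auto intro: bounded_operator_into_hs_class)
    have s0: "s \<ge> 0"
      by (simp add: s_def sum_nonneg)
    have "s = rinner x w"
      unfolding s_def w_def rinner_sum_right
      using H J Hx by (intro sum.cong refl) (auto simp: rinner_hs_adjoint Re_hs_inner_self)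
    also have "\<dots> \<le> norm x * norm w"
      by (rule rinner_le)
    also have "\<dots> \<le> norm x * (c * norm u)"
      unfolding w_def u_def by (intro mult_left_mono le J Hx norm_ge_zero)
    finally have "s\<^sup>2 \<le> (norm x * (c * norm u))\<^sup>2"
      using s0 by (rule power_mono)
    also have "\<dots> = (norm x)\<^sup>2 * c\<^sup>2 * (norm u)\<^sup>2"
      by (simp add: power_mult_distrib)
    also have "\<dots> \<le> (norm x)\<^sup>2 * c\<^sup>2 * (B * s)"
      unfolding u_def s_def using Hx by (intro mult_left_mono synthesis_bound [OF G B J]) auto
    finally have *: "s * s \<le> s * (B * c\<^sup>2 * (norm x)\<^sup>2)"
      by (simp add: power2_eq_square mult_ac)
    have "s \<le> B * c\<^sup>2 * (norm x)\<^sup>2"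
    proof (cases "s = 0")
      case False
      then show ?thesis
        using s0 by (intro mult_left_le_imp_le [OF *]) simp
    qed (use B in simp)
    then show ?thesis
      by (simp only: s_def)
  qed
  have "(\<lambda>i. (hs_norm E (H i x))\<^sup>2) summable_on I" for x
    by (rule nonneg_bdd_above_summable_on) (auto intro: bdd_aboveI2 fin)
  then show ?thesis
    unfolding hs_bessel_def using H by (auto intro: infsum_le_finite_sums fin)
qed

section \<open>Mixed frame operators\<close>

text \<open>
  A Cauchy criterion for unconditional convergence: the tails of \<open>g\<close> are small, and they dominate
  the sums of \<open>f\<close> over finite sets that avoid a large finite set. In general \<open>f\<close> need not be
  absolutely summable.
\<close>

lemma summable_on_of_square_bound:
  fixes f :: "'i \<Rightarrow> 'b::banach" and g :: "'i \<Rightarrow> real"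
  assumes g: "g summable_on I"
    and C: "C \<ge> 0"
    and le: "\<And>J. finite J \<Longrightarrow> J \<subseteq> I \<Longrightarrow> (norm (sum f J))\<^sup>2 \<le> C * sum g J"
    and nn: "\<And>i. i \<in> I \<Longrightarrow> g i \<ge> 0"
  shows "f summable_on I"
proof -
  have "\<exists>P. eventually P (finite_subsets_at_top I) \<and>
          (\<forall>F F'. P F \<and> P F' \<longrightarrow> dist (sum f F) (sum f F') < e)" if e: "e > 0" for e
  proof -
    define d where "d = (e/2)\<^sup>2 / (C + 1)"
    have d: "d > 0"
      using e C by (simp add: d_def)
    have "(sum g \<longlongrightarrow> infsum g I) (finite_subsets_at_top I)"
      using has_sum_infsum [OF g] by (simp add: has_sum_def)
    then have "eventually (\<lambda>F. sum g F > infsum g I - d) (finite_subsets_at_top I)"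
      by (rule order_tendstoD) (use d in simp)
    then obtain F0 where F0: "finite F0" "F0 \<subseteq> I" "sum g F0 > infsum g I - d"
      by (auto simp: eventually_finite_subsets_at_top)
    define P where "P F \<longleftrightarrow> finite F \<and> F0 \<subseteq> F \<and> F \<subseteq> I" for F
    have tail: "norm (sum f (F - F0)) < e/2" if "P F" for F
    proof -
      have F: "finite F" "F0 \<subseteq> F" "F \<subseteq> I"
        using that by (auto simp: P_def)
      have "sum g (F - F0) = sum g F - sum g F0"
        using F F0 by (simp add: sum_diff)
      also have "\<dots> < d"
        using F0 finite_sum_le_infsum [OF g, of F] F nn by auto
      finally have small: "sum g (F - F0) < d" .
      have nonneg: "sum g (F - F0) \<ge> 0"
        using F nn by (intro sum_nonneg) auto
      have "(norm (sum f (F - F0)))\<^sup>2 \<le> C * sum g (F - F0)"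
        using F by (intro le) auto
      also have "\<dots> \<le> (C + 1) * sum g (F - F0)"
        using nonneg by (simp add: algebra_simps)
      also have "\<dots> < (C + 1) * d"
        using C small by (intro mult_strict_left_mono) auto
      also have "\<dots> = (e/2)\<^sup>2"
        using C by (simp add: d_def)
      finally show ?thesis
        by (rule power2_less_imp_less) (use e in simp)
    qed
    have "dist (sum f F) (sum f F') < e" if "P F" "P F'" for F F'
    proof -
      have split: "sum f F = sum f F0 + sum f (F - F0)" if "P F" for F
        using that by (auto simp: P_def sum_diff F0)
      have "sum f F - sum f F' = sum f (F - F0) - sum f (F' - F0)"
        using split [OF \<open>P F\<close>] split [OF \<open>P F'\<close>] by simp
      then show ?thesis
        using norm_triangle_ineq4 [of "sum f (F - F0)" "sum f (F' - F0)"] tail [OF \<open>P F\<close>] tail [OF \<open>P F'\<close>]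
        by (simp add: dist_norm)
    qed
    moreover have "eventually P (finite_subsets_at_top I)"
      unfolding eventually_finite_subsets_at_top P_def using F0 by blast
    ultimately show ?thesis by blast
  qed
  then have "cauchy_filter (filtermap (sum f) (finite_subsets_at_top I))"
    by (simp add: cauchy_filter_metric_filtermap)
  moreover have "complete (UNIV::'b set)"
    by (rule complete_UNIV)
  ultimately obtain L' where \<open>(sum f \<longlongrightarrow> L') (finite_subsets_at_top I)\<close>
    using complete_uniform[where S=UNIV] by (force simp add: filterlim_def)
  then show ?thesis
    using summable_on_def has_sum_def by blast
qed

text \<open>
  The composition of the analysis operator of \<open>G\<close> with the synthesis operator of \<open>H\<close>; for \<open>H = G\<close>
  it is the frame operator of \<open>G\<close>.
\<close>

definition mixed_frame_operator ::
  "'k::complex_inner set \<Rightarrow> 'i set \<Rightarrow> ('i \<Rightarrow> 'h::complex_inner \<Rightarrow> 'k \<Rightarrow> 'k) \<Rightarrow>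
     ('i \<Rightarrow> 'h \<Rightarrow> 'k \<Rightarrow> 'k) \<Rightarrow> 'h \<Rightarrow> 'h" where
  "mixed_frame_operator E I H G z = (\<Sum>\<^sub>\<infinity>i\<in>I. hs_adjoint E (H i) (G i z))"

lemma has_sum_mixed_frame_operator:
  fixes G H :: "'i \<Rightarrow> 'h::chilbert_space \<Rightarrow> 'k::complex_inner \<Rightarrow> 'k"
  assumes G: "hs_bessel E I G B" and H: "hs_bessel E I H B'" and B': "B' \<ge> 0"
  shows "((\<lambda>i. hs_adjoint E (H i) (G i z)) has_sum mixed_frame_operator E I H G z) I"
proof -
  have "(\<lambda>i. hs_adjoint E (H i) (G i z)) summable_on I"
  proof (rule summable_on_of_square_bound)
    show "(\<lambda>i. (hs_norm E (G i z))\<^sup>2) summable_on I"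
      using G by (simp add: hs_bessel_def)
    show "(norm (\<Sum>i\<in>J. hs_adjoint E (H i) (G i z)))\<^sup>2 \<le> B' * (\<Sum>i\<in>J. (hs_norm E (G i z))\<^sup>2)"
      if "finite J" "J \<subseteq> I" for J
      using that G by (intro synthesis_bound [OF H B'])
        (auto simp: hs_bessel_def intro: bounded_operator_into_hs_class)
  qed (use B' in auto)
  then show ?thesis
    unfolding mixed_frame_operator_def by (rule has_sum_infsum)
qed

lemma mixed_frame_operator_diff:
  fixes G H :: "'i \<Rightarrow> 'h::chilbert_space \<Rightarrow> 'k::complex_inner \<Rightarrow> 'k"
  assumes G: "hs_bessel E I G B" and H: "hs_bessel E I H B'" and B': "B' \<ge> 0"
  shows "mixed_frame_operator E I H G (x - y)
           = mixed_frame_operator E I H G x - mixed_frame_operator E I H G y"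
proof -
  note hs = has_sum_mixed_frame_operator [OF G H B']
  have "((\<lambda>i. hs_adjoint E (H i) (G i (x - y)) + hs_adjoint E (H i) (G i y)) has_sum
          (mixed_frame_operator E I H G (x - y) + mixed_frame_operator E I H G y)) I"
    by (intro has_sum_add hs)
  moreover have "hs_adjoint E (H i) (G i (x - y)) + hs_adjoint E (H i) (G i y) = hs_adjoint E (H i) (G i x)"
    if "i \<in> I" for i
    using that G H by (simp add: hs_bessel_def hs_adjoint_apply_diff)
  ultimately have "((\<lambda>i. hs_adjoint E (H i) (G i x)) has_sum
          (mixed_frame_operator E I H G (x - y) + mixed_frame_operator E I H G y)) I"
    by (simp cong: has_sum_cong)
  then show ?thesis
    using has_sum_unique [OF hs] by fastforce
qed

lemma rinner_mixed_frame_operator_bound: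
  fixes G H :: "'i \<Rightarrow> 'h::chilbert_space \<Rightarrow> 'k::complex_inner \<Rightarrow> 'k"
  assumes G: "hs_bessel E I G B" and H: "hs_bessel E I H B'" and B': "B' \<ge> 0"
  shows "(rinner x (mixed_frame_operator E I H G z))\<^sup>2
           \<le> (\<Sum>\<^sub>\<infinity>i\<in>I. (hs_norm E (H i x))\<^sup>2) * (\<Sum>\<^sub>\<infinity>i\<in>I. (hs_norm E (G i z))\<^sup>2)"
proof (rule tendsto_upperbound)
  let ?F = "finite_subsets_at_top I"
  have "((\<lambda>J. \<Sum>i\<in>J. hs_adjoint E (H i) (G i z)) \<longlongrightarrow> mixed_frame_operator E I H G z) ?F"
    using has_sum_mixed_frame_operator [OF G H B'] by (simp add: has_sum_def)
  then show "((\<lambda>J. (rinner x (\<Sum>i\<in>J. hs_adjoint E (H i) (G i z)))\<^sup>2) \<longlongrightarrow>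
          (rinner x (mixed_frame_operator E I H G z))\<^sup>2) ?F"
    by (intro tendsto_power bounded_linear.tendsto [OF bounded_linear_rinner])
  show "\<forall>\<^sub>F J in ?F. (rinner x (\<Sum>i\<in>J. hs_adjoint E (H i) (G i z)))\<^sup>2
          \<le> (\<Sum>\<^sub>\<infinity>i\<in>I. (hs_norm E (H i x))\<^sup>2) * (\<Sum>\<^sub>\<infinity>i\<in>I. (hs_norm E (G i z))\<^sup>2)"
  proof (rule eventually_finite_subsets_at_top_weakI)
    fix J assume J: "finite J" "J \<subseteq> I"
    have "(rinner x (\<Sum>i\<in>J. hs_adjoint E (H i) (G i z)))\<^sup>2
            \<le> (\<Sum>i\<in>J. (hs_norm E (H i x))\<^sup>2) * (\<Sum>i\<in>J. (hs_norm E (G i z))\<^sup>2)"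
      using G H J by (intro synthesis_pairing_bound)
        (auto simp: hs_bessel_def intro: bounded_operator_into_hs_class)
    also have "\<dots> \<le> (\<Sum>\<^sub>\<infinity>i\<in>I. (hs_norm E (H i x))\<^sup>2) * (\<Sum>\<^sub>\<infinity>i\<in>I. (hs_norm E (G i z))\<^sup>2)"
      using G H J by (intro mult_mono finite_sum_le_infsum infsum_nonneg sum_nonneg)
        (auto simp: hs_bessel_def)
    finally show "(rinner x (\<Sum>i\<in>J. hs_adjoint E (H i) (G i z)))\<^sup>2
          \<le> (\<Sum>\<^sub>\<infinity>i\<in>I. (hs_norm E (H i x))\<^sup>2) * (\<Sum>\<^sub>\<infinity>i\<in>I. (hs_norm E (G i z))\<^sup>2)" .
  qed
qed simp

lemma rinner_frame_operator:
  fixes G :: "'i \<Rightarrow> 'h::chilbert_space \<Rightarrow> 'k::complex_inner \<Rightarrow> 'k"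
  assumes G: "hs_bessel E I G B" and B: "B \<ge> 0"
  shows "rinner z (mixed_frame_operator E I G G z) = (\<Sum>\<^sub>\<infinity>i\<in>I. (hs_norm E (G i z))\<^sup>2)"
proof -
  have "((\<lambda>i. rinner z (hs_adjoint E (G i) (G i z))) has_sum rinner z (mixed_frame_operator E I G G z)) I"
    by (intro has_sum_bounded_linear [OF bounded_linear_rinner] has_sum_mixed_frame_operator [OF G G B])
  moreover have "rinner z (hs_adjoint E (G i) (G i z)) = (hs_norm E (G i z))\<^sup>2" if "i \<in> I" for i
    using G that bounded_operator_into_hs_class [of E "G i" z]
    by (simp add: hs_bessel_def rinner_hs_adjoint Re_hs_inner_self)
  ultimately have "((\<lambda>i. (hs_norm E (G i z))\<^sup>2) has_sum rinner z (mixed_frame_operator E I G G z)) I"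
    by (simp cong: has_sum_cong)
  then show ?thesis
    by (simp add: infsumI)
qed

text \<open>
  Coercivity of the frame operator \<open>S\<close>, in the form that the surjectivity criterion needs, combines
  the lower frame bound with \<open>\<parallel>S z\<parallel>\<^sup>2 \<le> B \<langle>z, S z\<rangle>\<close>, which follows from pairing \<open>S z\<close> with itself. The
  second estimate is the bound \<open>\<langle>z, S z\<rangle> \<le> \<langle>S z, S z\<rangle> / A\<close> expected from \<open>S \<ge> A\<close>; inserting the lower frame
  bound into \<open>\<langle>z, S z\<rangle>\<^sup>2 \<le> \<parallel>z\<parallel>\<^sup>2 \<parallel>S z\<parallel>\<^sup>2\<close> proves it without using the inverse of \<open>S\<close>.
\<close>

lemma frame_operator_bounds:
  fixes G :: "'i \<Rightarrow> 'h::chilbert_space \<Rightarrow> 'k::complex_inner \<Rightarrow> 'k"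
  assumes G: "hs_frame E I G A B"
  defines "S \<equiv> mixed_frame_operator E I G G"
  shows "A * (norm z)\<^sup>2 + (1 / B) * (norm (S z))\<^sup>2 \<le> 2 * rinner z (S z)"
    and "A * rinner z (S z) \<le> (norm (S z))\<^sup>2"
proof -
  have A: "A > 0" and B: "B > 0" and bG: "hs_bessel E I G B"
    using G by (simp_all add: hs_frame_iff_bessel)
  define g where "g = rinner z (S z)"
  have g: "g = (\<Sum>\<^sub>\<infinity>i\<in>I. (hs_norm E (G i z))\<^sup>2)"
    using rinner_frame_operator [OF bG] B by (simp add: g_def S_def)
  have lower: "A * (norm z)\<^sup>2 \<le> g"
    using G by (simp add: g hs_frame_def)
  then have g0: "0 \<le> g"
    using A by (meson order_trans mult_nonneg_nonneg less_imp_le zero_le_power2)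
  have "((norm (S z))\<^sup>2)\<^sup>2 \<le> (\<Sum>\<^sub>\<infinity>i\<in>I. (hs_norm E (G i (S z)))\<^sup>2) * g"
    using rinner_mixed_frame_operator_bound [OF bG bG, of "S z" z] B by (simp add: S_def g rinner_self)
  also have "\<dots> \<le> (B * (norm (S z))\<^sup>2) * g"
    using bG by (intro mult_right_mono g0) (simp add: hs_bessel_def)
  finally have *: "(norm (S z))\<^sup>2 * (norm (S z))\<^sup>2 \<le> (norm (S z))\<^sup>2 * (B * g)"
    by (simp add: power2_eq_square mult_ac)
  have "(norm (S z))\<^sup>2 \<le> B * g"
  proof (cases "S z = 0")
    case False
    then show ?thesis
      by (intro mult_left_le_imp_le [OF *]) simp
  qed (use B g0 in simp)
  then have "(1 / B) * (norm (S z))\<^sup>2 \<le> g"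
    using B by (simp add: field_simps)
  then show "A * (norm z)\<^sup>2 + (1 / B) * (norm (S z))\<^sup>2 \<le> 2 * rinner z (S z)"
    using lower by (simp add: g_def)
  have "A * g\<^sup>2 \<le> A * (norm z * norm (S z))\<^sup>2"
    using A g0 by (intro mult_left_mono power_mono) (auto simp: g_def rinner_le)
  also have "\<dots> = (A * (norm z)\<^sup>2) * (norm (S z))\<^sup>2"
    by (simp add: power_mult_distrib)
  also have "\<dots> \<le> g * (norm (S z))\<^sup>2"
    by (intro mult_right_mono lower) simp
  finally have **: "g * (A * g) \<le> g * (norm (S z))\<^sup>2"
    by (simp add: power2_eq_square mult_ac)
  have "A * g \<le> (norm (S z))\<^sup>2"
  proof (cases "g = 0")
    case False
    then show ?thesis
      using g0 by (intro mult_left_le_imp_le [OF **]) simp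
  qed simp
  then show "A * rinner z (S z) \<le> (norm (S z))\<^sup>2"
    by (simp add: g_def)
qed

section \<open>Perturbation\<close>

text \<open>
  Since \<open>p a\<^sup>2 + q b\<^sup>2 \<le> (sqrt p a + sqrt q b)\<^sup>2\<close> for \<open>a, b \<ge> 0\<close>, the quadratic inequality implies a
  linear one, and the triangle inequality does the rest.
\<close>

lemma norm_comparison:
  fixes u w :: "'a::real_normed_vector"
  assumes p: "0 \<le> p" and q: "0 \<le> q"
    and le: "(norm (u - w))\<^sup>2 \<le> p * (norm u)\<^sup>2 + q * (norm w)\<^sup>2"
  shows "(1 - sqrt p) * norm u \<le> (1 + sqrt q) * norm w"
    and "(1 - sqrt q) * norm w \<le> (1 + sqrt p) * norm u"
proof -
  have "(norm (u - w))\<^sup>2 \<le> (sqrt p * norm u + sqrt q * norm w)\<^sup>2"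
    using le p q by (simp add: power2_sum power_mult_distrib add_increasing2)
  then have d: "norm (u - w) \<le> sqrt p * norm u + sqrt q * norm w"
    by (rule power2_le_imp_le) (use p q in simp)
  then show "(1 - sqrt p) * norm u \<le> (1 + sqrt q) * norm w"
    using norm_triangle_ineq2 [of u w] by (simp add: algebra_simps)
  show "(1 - sqrt q) * norm w \<le> (1 + sqrt p) * norm u"
    using d norm_triangle_ineq2 [of w u] by (simp add: algebra_simps norm_minus_commute)
qed

text \<open>
  As \<open>M\<close> is onto, \<open>x = M z\<close> for some \<open>z\<close>, which expresses \<open>x\<close> as a synthesis of \<open>H\<close> with coefficients
  \<open>G\<^sub>i z\<close> whose size is controlled by \<open>\<parallel>S z\<parallel>\<close>, hence by \<open>\<parallel>x\<parallel>\<close>. Pairing this synthesis with \<open>x\<close>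
  bounds \<open>\<parallel>x\<parallel>\<close> by the size of the family \<open>H\<^sub>i x\<close>.
\<close>

lemma perturbed_frame_lower_bound:
  fixes G H :: "'i \<Rightarrow> 'h::chilbert_space \<Rightarrow> 'k::complex_inner \<Rightarrow> 'k"
  assumes G: "hs_frame E I G A B" and H: "hs_bessel E I H B'" and B': "B' \<ge> 0"
    and p: "0 \<le> p" "p < 1" and q: "0 \<le> q" "q < 1"
    and le: "\<And>J T. finite J \<Longrightarrow> J \<subseteq> I \<Longrightarrow> \<forall>i\<in>J. T i \<in> hs_class E \<Longrightarrow>
         (norm ((\<Sum>i\<in>J. hs_adjoint E (G i) (T i)) - (\<Sum>i\<in>J. hs_adjoint E (H i) (T i))))\<^sup>2
           \<le> p * (norm (\<Sum>i\<in>J. hs_adjoint E (G i) (T i)))\<^sup>2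
             + q * (norm (\<Sum>i\<in>J. hs_adjoint E (H i) (T i)))\<^sup>2"
  shows "A * ((1 - sqrt p) / (1 + sqrt q))\<^sup>2 * (norm x)\<^sup>2 \<le> (\<Sum>\<^sub>\<infinity>i\<in>I. (hs_norm E (H i x))\<^sup>2)"
proof -
  have A: "A > 0" and B: "B > 0" "B \<ge> 0" and bG: "hs_bessel E I G B"
    using G by (simp_all add: hs_frame_iff_bessel)
  define S where "S = mixed_frame_operator E I G G"
  define M where "M = mixed_frame_operator E I H G"
  have diffS: "S (y - z) = S y - S z" for y z
    unfolding S_def by (rule mixed_frame_operator_diff [OF bG bG B(2)])
  have diffM: "M (y - z) = M y - M z" for y z
    unfolding M_def by (rule mixed_frame_operator_diff [OF bG H B'])
  have SM: "(norm (S z - M z))\<^sup>2 \<le> p * (norm (S z))\<^sup>2 + q * (norm (M z))\<^sup>2" for z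
  proof (rule tendsto_le)
    let ?F = "finite_subsets_at_top I"
    let ?u = "\<lambda>J. \<Sum>i\<in>J. hs_adjoint E (G i) (G i z)"
    let ?w = "\<lambda>J. \<Sum>i\<in>J. hs_adjoint E (H i) (G i z)"
    have u: "(?u \<longlongrightarrow> S z) ?F"
      using has_sum_mixed_frame_operator [OF bG bG B(2)] by (simp add: has_sum_def S_def)
    have w: "(?w \<longlongrightarrow> M z) ?F"
      using has_sum_mixed_frame_operator [OF bG H B'] by (simp add: has_sum_def M_def)
    show "((\<lambda>J. (norm (?u J - ?w J))\<^sup>2) \<longlongrightarrow> (norm (S z - M z))\<^sup>2) ?F"
      by (intro tendsto_intros u w)
    show "((\<lambda>J. p * (norm (?u J))\<^sup>2 + q * (norm (?w J))\<^sup>2) \<longlongrightarrow>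
             p * (norm (S z))\<^sup>2 + q * (norm (M z))\<^sup>2) ?F"
      by (intro tendsto_intros u w)
    show "\<forall>\<^sub>F J in ?F. (norm (?u J - ?w J))\<^sup>2 \<le> p * (norm (?u J))\<^sup>2 + q * (norm (?w J))\<^sup>2"
      using bG by (intro eventually_finite_subsets_at_top_weakI le)
        (auto simp: hs_bessel_def intro: bounded_operator_into_hs_class)
  qed simp
  have "surj S"
  proof (rule accretive_pair_surj [where S = "\<lambda>z. z"])
    show "A * (norm z)\<^sup>2 + (1 / B) * (norm (S z))\<^sup>2 \<le> 2 * rinner z (S z)" for z
      unfolding S_def by (rule frame_operator_bounds [OF G])
  qed (use A B diffS in auto)
  have "surj M"
  proof (rule accretive_pair_surj [OF \<open>surj S\<close>])
    \<comment> \<open>This is \<open>SM\<close> with the square on its left-hand side expanded.\<close>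
    show "(1 - p) * (norm (S z))\<^sup>2 + (1 - q) * (norm (M z))\<^sup>2 \<le> 2 * rinner (S z) (M z)" for z
      using SM [of z] by (simp add: norm_diff_square algebra_simps)
    show "\<exists>z. S z = S x - S y \<and> M z = M x - M y" for x y
      using diffS diffM by blast
  qed (use p q in auto)
  then obtain z where z: "x = M z"
    by (metis surjD)
  define h where "h = (\<Sum>\<^sub>\<infinity>i\<in>I. (hs_norm E (H i x))\<^sup>2)"
  have h: "h \<ge> 0"
    by (simp add: h_def infsum_nonneg)
  have sp: "sqrt p < 1" and sq: "0 \<le> sqrt q"
    using p q by auto
  have Sz: "(1 - sqrt p)\<^sup>2 * (norm (S z))\<^sup>2 \<le> (1 + sqrt q)\<^sup>2 * (norm x)\<^sup>2"
    using power_mono [OF norm_comparison(1) [OF p(1) q(1) SM [of z]], of 2] sp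
    by (simp add: z power_mult_distrib)
  have "((norm x)\<^sup>2)\<^sup>2 \<le> h * rinner z (S z)"
    using rinner_mixed_frame_operator_bound [OF bG H B', of x z] rinner_frame_operator [OF bG B(2), of z]
    by (simp add: h_def S_def rinner_self flip: M_def z)
  then have "A * ((norm x)\<^sup>2)\<^sup>2 \<le> h * (A * rinner z (S z))"
    using A by (simp add: mult.left_commute)
  also have "\<dots> \<le> h * (norm (S z))\<^sup>2"
    unfolding S_def by (intro mult_left_mono frame_operator_bounds [OF G] h)
  finally have "(1 - sqrt p)\<^sup>2 * (A * ((norm x)\<^sup>2)\<^sup>2) \<le> (1 - sqrt p)\<^sup>2 * (h * (norm (S z))\<^sup>2)"
    by (rule mult_left_mono) simp
  also have "\<dots> \<le> h * ((1 + sqrt q)\<^sup>2 * (norm x)\<^sup>2)"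
    using mult_left_mono [OF Sz h] by (simp only: mult_ac)
  finally have *: "(norm x)\<^sup>2 * (A * (1 - sqrt p)\<^sup>2 * (norm x)\<^sup>2) \<le> (norm x)\<^sup>2 * (h * (1 + sqrt q)\<^sup>2)"
    by (simp add: power2_eq_square mult_ac)
  have "A * (1 - sqrt p)\<^sup>2 * (norm x)\<^sup>2 \<le> h * (1 + sqrt q)\<^sup>2"
  proof (cases "x = 0")
    case False
    then show ?thesis
      by (intro mult_left_le_imp_le [OF *]) simp
  qed (use h in simp)
  moreover have "0 < (1 + sqrt q)\<^sup>2"
    by (rule zero_less_power [OF add_pos_nonneg [OF zero_less_one sq]])
  ultimately have "A * (1 - sqrt p)\<^sup>2 * (norm x)\<^sup>2 / (1 + sqrt q)\<^sup>2 \<le> h"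
    by (simp only: pos_divide_le_eq)
  then show ?thesis
    by (simp add: h_def power_divide)
qed

lemma product_le_weighted_squares:
  fixes a b \<epsilon> :: real
  assumes "\<epsilon> > 0"
  shows "a * b \<le> \<epsilon> * a\<^sup>2 + b\<^sup>2 / (4 * \<epsilon>)"
proof -
  have "0 \<le> (2 * \<epsilon> * a - b)\<^sup>2 / (4 * \<epsilon>)"
    using assms by simp
  also have "\<dots> = \<epsilon> * a\<^sup>2 + b\<^sup>2 / (4 * \<epsilon>) - a * b"
    using assms by (simp add: power2_diff field_simps power2_eq_square)
  finally show ?thesis by simp
qed

theorem theorem3p4:
  fixes E :: "'k::chilbert_space set"
    and I :: "'i set"
    and G H :: "'i \<Rightarrow> 'h::chilbert_space \<Rightarrow> 'k \<Rightarrow> 'k"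
    and A B lam \<mu> \<nu> \<epsilon> :: real
  assumes "separable_space (euclidean :: 'h topology)"
    and "separable_space (euclidean :: 'k topology)"
    and "countable I"
    and "orthonormal_basis E"
    and "hs_frame E I G A B"
    and "\<forall>i\<in>I. bounded_operator_into_hs E (H i)"
    and "lam \<ge> 0" and "\<mu> \<ge> 0" and "\<nu> \<ge> 0"
    and "\<And>(J :: 'i set) (T :: 'i \<Rightarrow> 'k \<Rightarrow> 'k).
           finite J \<Longrightarrow> J \<subseteq> I \<Longrightarrow> (\<forall>i\<in>J. T i \<in> hs_class E) \<Longrightarrow>
           (norm (\<Sum>i\<in>J. hs_adjoint E (G i) (T i) - hs_adjoint E (H i) (T i)))\<^sup>2
             \<le> lam * (norm (\<Sum>i\<in>J. hs_adjoint E (G i) (T i)))\<^sup>2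
               + \<mu> * norm (\<Sum>i\<in>J. hs_adjoint E (G i) (T i)) * norm (\<Sum>i\<in>J. hs_adjoint E (H i) (T i))
               + \<nu> * (norm (\<Sum>i\<in>J. hs_adjoint E (H i) (T i)))\<^sup>2"
    and "\<epsilon> > 0" and "max (lam + \<mu> * \<epsilon>) (\<nu> + \<mu> / (4 * \<epsilon>)) < 1"
  shows "hs_frame E I H
             (A * ((1 - sqrt (lam + \<mu> * \<epsilon>)) / (1 + sqrt (\<nu> + \<mu> / (4 * \<epsilon>))))\<^sup>2)
             (B * ((1 + sqrt (lam + \<mu> * \<epsilon>)) / (1 - sqrt (\<nu> + \<mu> / (4 * \<epsilon>))))\<^sup>2)"
proof -
  define p where "p = lam + \<mu> * \<epsilon>"
  define q where "q = \<nu> + \<mu> / (4 * \<epsilon>)"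
  have p: "0 \<le> p" "p < 1" and q: "0 \<le> q" "q < 1"
    using assms by (simp_all add: p_def q_def)
  have sqrts: "0 \<le> sqrt p" "sqrt p < 1" "0 \<le> sqrt q" "sqrt q < 1"
    using p q by auto
  have A: "A > 0" and B: "B > 0" "B \<ge> 0" and G: "hs_bessel E I G B"
    using assms(5) by (simp_all add: hs_frame_iff_bessel)
  have le: "(norm ((\<Sum>i\<in>J. hs_adjoint E (G i) (T i)) - (\<Sum>i\<in>J. hs_adjoint E (H i) (T i))))\<^sup>2
           \<le> p * (norm (\<Sum>i\<in>J. hs_adjoint E (G i) (T i)))\<^sup>2
             + q * (norm (\<Sum>i\<in>J. hs_adjoint E (H i) (T i)))\<^sup>2"
    if "finite J" "J \<subseteq> I" "\<forall>i\<in>J. T i \<in> hs_class E" for J T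
  proof -
    define a where "a = norm (\<Sum>i\<in>J. hs_adjoint E (G i) (T i))"
    define b where "b = norm (\<Sum>i\<in>J. hs_adjoint E (H i) (T i))"
    have "(norm ((\<Sum>i\<in>J. hs_adjoint E (G i) (T i)) - (\<Sum>i\<in>J. hs_adjoint E (H i) (T i))))\<^sup>2
            \<le> lam * a\<^sup>2 + \<mu> * (a * b) + \<nu> * b\<^sup>2"
      using assms(10) [OF that] by (simp add: a_def b_def sum_subtractf mult.assoc)
    also have "\<dots> \<le> lam * a\<^sup>2 + \<mu> * (\<epsilon> * a\<^sup>2 + b\<^sup>2 / (4 * \<epsilon>)) + \<nu> * b\<^sup>2"
      using product_le_weighted_squares [OF assms(11), of a b] assms(8)
      by (intro add_mono mult_left_mono order_refl)
    also have "\<dots> = p * a\<^sup>2 + q * b\<^sup>2"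
      by (simp add: p_def q_def algebra_simps)
    finally show ?thesis
      by (simp only: a_def b_def)
  qed
  have H: "hs_bessel E I H (B * ((1 + sqrt p) / (1 - sqrt q))\<^sup>2)"
  proof (rule bessel_of_synthesis_comparison [OF G B(2)])
    fix J T assume JT: "finite J" "J \<subseteq> I" "\<forall>i\<in>J. T i \<in> hs_class E"
    show "norm (\<Sum>i\<in>J. hs_adjoint E (H i) (T i))
            \<le> (1 + sqrt p) / (1 - sqrt q) * norm (\<Sum>i\<in>J. hs_adjoint E (G i) (T i))"
      using norm_comparison(2) [OF p(1) q(1) le [OF JT]] sqrts by (simp add: field_simps)
  qed (use assms(6) sqrts in auto)
  have ratios: "0 < (1 - sqrt p) / (1 + sqrt q)" "0 < (1 + sqrt p) / (1 - sqrt q)"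
    using sqrts by (intro divide_pos_pos; linarith)+
  have "hs_frame E I H (A * ((1 - sqrt p) / (1 + sqrt q))\<^sup>2) (B * ((1 + sqrt p) / (1 - sqrt q))\<^sup>2)"
    unfolding hs_frame_iff_bessel
  proof (intro conjI allI H)
    show "A * ((1 - sqrt p) / (1 + sqrt q))\<^sup>2 * (norm x)\<^sup>2 \<le> (\<Sum>\<^sub>\<infinity>i\<in>I. (hs_norm E (H i x))\<^sup>2)" for x
      by (rule perturbed_frame_lower_bound [OF assms(5) H _ p q le]) (use B in auto)
  qed (use A B ratios in \<open>simp_all only: mult_pos_pos zero_less_power\<close>)
  then show ?thesis
    by (simp only: p_def q_def)
qed

end
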